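(* Let $\mathcal{H}$ be the property of all simple ordered graphs $G$ for which there do not exist vertices $u_1<u_2\le u_3<u_4$ in $G$ such that $u_1u_2$ is a non-edge and $u_3u_4$ is an edge. For $n\in\mathbb{N}$, consider the simple graph $G=G_n$ on the vertex set $[n]$ with the standard ordering, where distinct $u$ and $v$ are connected if and only if $u+v\ge n$. Then $d_1(G_n,\mathcal{H})\ge\tfrac12-o(1)$ as $n\to\infty$.
   Context: A simple ordered graph on $n$ vertices is a loopless graph on $[n]$ with its natural order. For ordered graphs $G,G'$ on $n$ vertices, $d_1(G,G')$ is the number of entries in which their $n\times n$ adjacency matrices differ, divided by $n^2$; $d_1(G,\mathcal{H})=\min_{G'}d_1(G,G')$ over all $G'\in\mathcal{H}$ with the same number of vertices as $G$. *)

theory Defs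
  imports Complex_Main "HOL-Library.Landau_Symbols"
begin

(* A graph on [n] = {1..n} is the pair of n and its set of edges, an edge being a
   2-element subset of [n]; the ordering of the vertices is that of the naturals. *)
type_synonym ordered_graph = "nat \<times> nat set set"

abbreviation nverts :: "ordered_graph \<Rightarrow> nat" where
  "nverts G \<equiv> fst G"

abbreviation edges :: "ordered_graph \<Rightarrow> nat set set" where
  "edges G \<equiv> snd G"

definition simple_ordered_graph :: "ordered_graph \<Rightarrow> bool" where
  "simple_ordered_graph G \<longleftrightarrow> edges G \<subseteq> {e. e \<subseteq> {1..nverts G} \<and> card e = 2}"

definition adjacency :: "ordered_graph \<Rightarrow> nat \<Rightarrow> nat \<Rightarrow> nat" where
  "adjacency G i j = (if {i, j} \<in> edges G then 1 else 0)"

(* Only meaningful for graphs of the same order. All n^2 ordered pairs (i, j) are counted,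
   so an edge lying in exactly one of the two graphs contributes 2 differing entries. *)
definition d1 :: "ordered_graph \<Rightarrow> ordered_graph \<Rightarrow> real" where
  "d1 G G' =
     real (card {(i, j) \<in> {1..nverts G} \<times> {1..nverts G}. adjacency G i j \<noteq> adjacency G' i j})
       / real (nverts G) ^ 2"

(* Min {} is unspecified, so P should contain a graph of the same order as G. *)
definition d1_property :: "ordered_graph \<Rightarrow> ordered_graph set \<Rightarrow> real" where
  "d1_property G P = Min {d1 G G' | G'. G' \<in> P \<and> nverts G' = nverts G}"

definition \<H> :: "ordered_graph set" where
  "\<H> = {G. simple_ordered_graph G \<and>
     \<not> (\<exists>u\<^sub>1\<in>{1..nverts G}. \<exists>u\<^sub>2\<in>{1..nverts G}. \<exists>u\<^sub>3\<in>{1..nverts G}. \<exists>u\<^sub>4\<in>{1..nverts G}.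
          u\<^sub>1 < u\<^sub>2 \<and> u\<^sub>2 \<le> u\<^sub>3 \<and> u\<^sub>3 < u\<^sub>4 \<and> {u\<^sub>1, u\<^sub>2} \<notin> edges G \<and> {u\<^sub>3, u\<^sub>4} \<in> edges G)}"

definition Gn :: "nat \<Rightarrow> ordered_graph" where
  "Gn n = (n, {{u, v} | u v. u \<in> {1..n} \<and> v \<in> {1..n} \<and> u \<noteq> v \<and> u + v \<ge> n})"

lemma nverts_Gn [simp]: "nverts (Gn n) = n"
  by (simp add: Gn_def)

lemma simple_ordered_graph_Gn: "simple_ordered_graph (Gn n)"
  by (auto simp: simple_ordered_graph_def Gn_def)

lemma finite_simple_ordered_graphs: "finite {G. simple_ordered_graph G \<and> nverts G = n}"
proof (rule finite_subset)
  show "{G. simple_ordered_graph G \<and> nverts G = n} \<subseteq> {n} \<times> Pow (Pow {1..n})"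
    by (auto simp: simple_ordered_graph_def)
qed simp

lemma empty_graph_in_H: "(n, {}) \<in> \<H>"
  by (simp add: \<H>_def simple_ordered_graph_def)

(* The minimum over \<H> is taken over a finite nonempty set, and so is attained. *)
lemma d1_property_H_attained:
  "\<exists>G'\<in>\<H>. nverts G' = nverts G \<and> d1_property G \<H> = d1 G G'"
proof -
  let ?S = "{G'. G' \<in> \<H> \<and> nverts G' = nverts G}"
  have "finite ?S"
    by (rule finite_subset[OF _ finite_simple_ordered_graphs[of "nverts G"]]) (auto simp: \<H>_def)
  moreover have "?S \<noteq> {}"
    using empty_graph_in_H[of "nverts G"] by force
  ultimately have "Min (d1 G ` ?S) \<in> d1 G ` ?S"
    by (intro Min_in) auto
  moreover have "d1_property G \<H> = Min (d1 G ` ?S)"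
    unfolding d1_property_def by (rule arg_cong[where f = Min]) blast
  ultimately show ?thesis by auto
qed

end

theory Submission imports Defs begin

text \<open>
  Every graph of \<open>\<H>\<close> splits at some \<open>t\<close> (\<open>H_clique_then_independent\<close>): \<open>[1..t]\<close> is a clique and
  \<open>[t+1..n]\<close> is independent, while nothing is known about the pairs across. So such a graph
  differs from \<open>G\<^sub>n\<close> at all \<open>i \<noteq> j\<close> in \<open>[1..t]\<close> with \<open>i + j < n\<close> and at all \<open>i \<noteq> j\<close> in
  \<open>[t+1..n]\<close> with \<open>i + j \<ge> n\<close>. For \<open>t = 0\<close> these fill the half \<open>i + j \<ge> n\<close> of the
  \<open>n \<times> n\<close> square and for \<open>t = n\<close> the other half; the point is that they number about
  \<open>n\<^sup>2 / 2\<close> for every \<open>t\<close>. The reason is a cancellation between rows: for each \<open>t\<close> and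
  each \<open>u\<close> with \<open>1 \<le> u < n\<close>, the rows \<open>u\<close> and \<open>n - u\<close> together contain at least
  \<open>n - 4\<close> of these entries (\<open>opposite_rows_disagreements\<close>). Summing over \<open>u\<close> gives at least \<open>(n - 1) (n - 4) / 2\<close>
  disagreements, whatever the graph of \<open>\<H>\<close> is.
\<close>

text \<open>
  The split is at the largest \<open>t\<close> for which \<open>[1..t]\<close> is a clique. Unless \<open>t = n\<close>,
  \<open>[1..t+1]\<close> then contains a non-edge \<open>u\<^sub>1u\<^sub>2\<close>, and as \<open>u\<^sub>2 \<le> t + 1\<close>, an edge \<open>u\<^sub>3u\<^sub>4\<close> in \<open>[t+1..n]\<close> would complete
  the forbidden configuration.
\<close>

lemma H_clique_then_independent:
  assumes "G \<in> \<H>"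
  obtains t where
    "\<And>i j. i \<in> {1..t} \<Longrightarrow> j \<in> {1..t} \<Longrightarrow> i \<noteq> j \<Longrightarrow> {i, j} \<in> edges G"
    "\<And>i j. i \<in> {t<..nverts G} \<Longrightarrow> j \<in> {t<..nverts G} \<Longrightarrow> i \<noteq> j \<Longrightarrow> {i, j} \<notin> edges G"
proof -
  define n where "n = nverts G"
  define clique where "clique t \<longleftrightarrow> t \<le> n \<and> (\<forall>a b. 1 \<le> a \<and> a < b \<and> b \<le> t \<longrightarrow> {a, b} \<in> edges G)" for t
  define t where "t = Greatest clique"
  have bound: "s \<le> n" if "clique s" for s
    using that by (simp add: clique_def)
  have "clique 0"
    by (simp add: clique_def)
  then have t: "clique t"
    unfolding t_def using bound by (rule GreatestI_nat)
  have up: "{a, b} \<notin> edges G" if ab: "t < a" "a < b" "b \<le> n" for a b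
  proof -
    have "\<not> clique (Suc t)"
      using Greatest_le_nat[of clique "Suc t" n] bound unfolding t_def by fastforce
    then obtain c d where cd: "1 \<le> c" "c < d" "d \<le> Suc t" "{c, d} \<notin> edges G"
      using ab by (auto simp: clique_def)
    have "c \<in> {1..n}" "d \<in> {1..n}" "a \<in> {1..n}" "b \<in> {1..n}" "d \<le> a"
      using ab cd by auto
    then show ?thesis
      using assms ab cd unfolding \<H>_def n_def by blast
  qed
  have sorted: "{min i j, max i j} = {i, j}" for i j :: nat
    by (auto simp: min_def max_def)
  show thesis
  proof
    fix i j assume "i \<in> {1..t}" "j \<in> {1..t}" "i \<noteq> j"
    then have "{min i j, max i j} \<in> edges G"
      using t unfolding clique_def by auto
    then show "{i, j} \<in> edges G"
      unfolding sorted .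
  next
    fix i j assume "i \<in> {t<..nverts G}" "j \<in> {t<..nverts G}" "i \<noteq> j"
    then have "{min i j, max i j} \<notin> edges G"
      by (intro up) (auto simp: n_def)
    then show "{i, j} \<notin> edges G"
      unfolding sorted .
  qed
qed

definition disagreements :: "ordered_graph \<Rightarrow> ordered_graph \<Rightarrow> nat \<Rightarrow> nat set" where
  "disagreements G G' i = {j \<in> {1..nverts G}. adjacency G i j \<noteq> adjacency G' i j}"

lemma finite_disagreements [simp]: "finite (disagreements G G' i)"
  by (simp add: disagreements_def)

lemma d1_eq_sum_rows:
  "d1 G G' = real (\<Sum>i\<in>{1..nverts G}. card (disagreements G G' i)) / real (nverts G) ^ 2"
proof -
  have "{(i, j) \<in> {1..nverts G} \<times> {1..nverts G}. adjacency G i j \<noteq> adjacency G' i j}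
      = (SIGMA i:{1..nverts G}. disagreements G G' i)"
    by (auto simp: disagreements_def)
  then show ?thesis
    by (simp add: d1_def)
qed

lemma adjacency_Gn:
  assumes "i \<in> {1..n}" "j \<in> {1..n}"
  shows "adjacency (Gn n) i j = (if i \<noteq> j \<and> n \<le> i + j then 1 else 0)"
  using assms by (auto simp: adjacency_def Gn_def doubleton_eq_iff add.commute)

text \<open>
  If \<open>u\<close> and \<open>n - u\<close> lie in the clique, their rows disagree before columns \<open>n - u\<close> and \<open>u\<close>; if
  both lie in the independent part, from columns \<open>n - u\<close> and \<open>u\<close> on; in either case the two
  lengths add up to about \<open>n\<close>. If \<open>t\<close> separates them, the row of the smaller disagrees on the
  columns up to \<open>t\<close> and the row of the larger on those after \<open>t\<close>. Two entries are lost to the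
  diagonal, and two more to the entries on the antidiagonal in the first case.
\<close>

lemma opposite_rows_disagreements:
  assumes "G \<in> \<H>" "nverts G = n" "u \<in> {1..<n}"
  shows "n \<le> card (disagreements (Gn n) G u) + card (disagreements (Gn n) G (n - u)) + 4"
proof -
  obtain t where
    clique: "\<And>i j. i \<in> {1..t} \<Longrightarrow> j \<in> {1..t} \<Longrightarrow> i \<noteq> j \<Longrightarrow> {i, j} \<in> edges G" and
    indep: "\<And>i j. i \<in> {t<..n} \<Longrightarrow> j \<in> {t<..n} \<Longrightarrow> i \<noteq> j \<Longrightarrow> {i, j} \<notin> edges G"
    using H_clique_then_independent[OF assms(1)] assms(2) by metis
  let ?R = "disagreements (Gn n) G"
  have low: "m \<le> card (?R i) + 1" if "i \<in> {1..n}" "i \<le> t" "m \<le> t" "m + i < n" for i m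
  proof -
    have "{1..m} - {i} \<subseteq> ?R i"
    proof
      fix j assume j: "j \<in> {1..m} - {i}"
      then have "adjacency (Gn n) i j = 0"
        using that by (subst adjacency_Gn) auto
      moreover have "adjacency G i j = 1"
        using that j clique[of i j] by (auto simp: adjacency_def)
      ultimately show "j \<in> ?R i"
        using that j by (auto simp: disagreements_def)
    qed
    from card_mono[OF _ this] show ?thesis
      using diff_card_le_card_Diff[of "{i}" "{1..m}"] by simp
  qed
  have high: "n \<le> card (?R i) + m + 1" if "i \<in> {1..n}" "t < i" "t \<le> m" "n \<le> Suc m + i" for i m
  proof -
    have "{m<..n} - {i} \<subseteq> ?R i"
    proof
      fix j assume j: "j \<in> {m<..n} - {i}"
      then have "adjacency (Gn n) i j = 1"
        using that by (subst adjacency_Gn) auto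
      moreover have "adjacency G i j = 0"
        using that j indep[of i j] by (auto simp: adjacency_def)
      ultimately show "j \<in> ?R i"
        using that j by (auto simp: disagreements_def)
    qed
    from card_mono[OF _ this] show ?thesis
      using diff_card_le_card_Diff[of "{i}" "{m<..n}"] by simp
  qed
  consider "u \<le> t" "n - u \<le> t" | "u \<le> t" "t < n - u" | "t < u" "n - u \<le> t" | "t < u" "t < n - u"
    by linarith
  then show ?thesis
  proof cases
    case 1
    have "n - u - 1 \<le> card (?R u) + 1"
      by (rule low) (use 1 assms(3) in auto)
    moreover have "u - 1 \<le> card (?R (n - u)) + 1"
      by (rule low) (use 1 assms(3) in auto)
    ultimately show ?thesis
      using assms(3) by auto
  next
    case 2
    have "t \<le> card (?R u) + 1"
      by (rule low) (use 2 assms(3) in auto)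
    moreover have "n \<le> card (?R (n - u)) + t + 1"
      by (rule high) (use 2 assms(3) in auto)
    ultimately show ?thesis
      by linarith
  next
    case 3
    have "t \<le> card (?R (n - u)) + 1"
      by (rule low) (use 3 assms(3) in auto)
    moreover have "n \<le> card (?R u) + t + 1"
      by (rule high) (use 3 assms(3) in auto)
    ultimately show ?thesis
      by linarith
  next
    case 4
    have "n \<le> card (?R u) + (n - u - 1) + 1"
      by (rule high) (use 4 assms(3) in auto)
    moreover have "n \<le> card (?R (n - u)) + (u - 1) + 1"
      by (rule high) (use 4 assms(3) in auto)
    ultimately show ?thesis
      using assms(3) by auto
  qed
qed

lemma disagreements_total_ge:
  assumes "G \<in> \<H>" "nverts G = n" "0 < n"
  shows "(real n - 1) * (real n - 4) \<le> 2 * real (\<Sum>u\<in>{1..n}. card (disagreements (Gn n) G u))"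
proof -
  define r where "r u = real (card (disagreements (Gn n) G u))" for u
  have "(real n - 1) * (real n - 4) = (\<Sum>u\<in>{1..<n}. real n - 4)"
    using assms(3) by (simp add: of_nat_diff)
  also have "\<dots> \<le> (\<Sum>u\<in>{1..<n}. r u + r (n - u))"
  proof (rule sum_mono)
    fix u assume "u \<in> {1..<n}"
    from opposite_rows_disagreements[OF assms(1,2) this]
    show "real n - 4 \<le> r u + r (n - u)"
      unfolding r_def by linarith
  qed
  also have "\<dots> = (\<Sum>u\<in>{1..<n}. r u) + (\<Sum>u\<in>{1..<n}. r (n - u))"
    by (rule sum.distrib)
  also have "(\<Sum>u\<in>{1..<n}. r (n - u)) = (\<Sum>u\<in>{1..<n}. r u)"
    by (rule sum.reindex_bij_witness[of _ "\<lambda>u. n - u" "\<lambda>u. n - u"]) auto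
  also have "(\<Sum>u\<in>{1..<n}. r u) + (\<Sum>u\<in>{1..<n}. r u) \<le> 2 * (\<Sum>u\<in>{1..n}. r u)"
  proof -
    have "(\<Sum>u\<in>{1..<n}. r u) \<le> (\<Sum>u\<in>{1..n}. r u)"
      by (rule sum_mono2) (auto simp: r_def)
    then show ?thesis
      by simp
  qed
  finally show ?thesis
    by (simp add: r_def)
qed

theorem lemma7p3:
  "\<exists>\<epsilon> :: nat \<Rightarrow> real. \<epsilon> \<in> o(\<lambda>_. 1) \<and> (\<forall>n. d1_property (Gn n) \<H> \<ge> 1 / 2 - \<epsilon> n)"
proof (intro exI conjI allI)
  \<comment> \<open>The count gives an error of \<open>(5 n - 4) / (2 n\<^sup>2)\<close>, which is at most \<open>3 / (n + 1)\<close> for \<open>n \<ge> 1\<close>;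
    this form also covers \<open>n = 0\<close>, where the distance is \<open>0 / 0 = 0\<close>.\<close>
  let ?\<epsilon> = "\<lambda>n. 3 / real (Suc n)"
  have "?\<epsilon> \<longlonglongrightarrow> 0"
    using tendsto_mult_right_zero[OF LIMSEQ_inverse_real_of_nat, of 3] by (simp add: field_simps)
  then show "?\<epsilon> \<in> o(\<lambda>_. 1)"
    by (intro smalloI_tendsto) auto
  fix n
  obtain G where G: "G \<in> \<H>" "nverts G = n" "d1_property (Gn n) \<H> = d1 (Gn n) G"
    using d1_property_H_attained[of "Gn n"] by auto
  show "d1_property (Gn n) \<H> \<ge> 1 / 2 - ?\<epsilon> n"
  proof (cases "n = 0")
    case True
    then show ?thesis
      unfolding G(3) by (simp add: d1_def)
  next
    case False
    define x where "x = real n"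
    define S where "S = real (\<Sum>u\<in>{1..n}. card (disagreements (Gn n) G u))"
    have x: "x \<ge> 1"
      using False by (simp add: x_def)
    have "(x - 1) * (x - 4) \<le> 2 * S"
      using disagreements_total_ge[OF G(1,2)] False by (simp add: x_def S_def)
    then have "(x - 1) * (x - 4) / (2 * x\<^sup>2) \<le> S / x\<^sup>2"
      using divide_right_mono[of _ "2 * S" "2 * x\<^sup>2"] by simp
    moreover have "1 / 2 - 3 / (x + 1) \<le> (x - 1) * (x - 4) / (2 * x\<^sup>2)"
    proof -
      have "(x - 1) * (x - 4) / (2 * x\<^sup>2) - (1 / 2 - 3 / (x + 1)) = (x\<^sup>2 - x + 4) / (2 * x\<^sup>2 * (x + 1))"
        using x by (simp add: divide_simps) (simp add: algebra_simps power2_eq_square)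
      moreover have "x\<^sup>2 - x + 4 \<ge> 0"
        using x mult_left_mono[of 1 x x] by (simp add: power2_eq_square)
      ultimately show ?thesis
        using x by (smt (verit) divide_nonneg_nonneg mult_nonneg_nonneg zero_le_power2)
    qed
    moreover have "d1 (Gn n) G = S / x\<^sup>2"
      by (simp add: d1_eq_sum_rows S_def x_def)
    ultimately show ?thesis
      by (simp add: G(3) x_def add.commute)
  qed
qed

end
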